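(* Let $T : \mathrm{Hol}(\mathbb{C}) \to \mathrm{Hol}(\mathbb{C})$ be a linear operator such that $\|Tf\|_{\infty,\rho} = \|f\|_{\infty,\rho}$ for all $f \in \mathrm{Hol}(\mathbb{C})$ and all $\rho \ge 0$. Then there exist $\alpha, \beta \in \mathbb{T}$ such that $T(f)(z) = \alpha f(\beta z)$ for all $f \in \mathrm{Hol}(\mathbb{C})$ and all $z \in \mathbb{C}$.
   Context: $\mathrm{Hol}(\mathbb{C})$ is the space of entire functions, $\mathbb{T}$ is the unit circle of $\mathbb{C}$, and for $\rho \ge 0$, $\|f\|_{\infty,\rho} := \sup_{|z| \le \rho} |f(z)|$. *)

theory Defs
  imports "HOL-Complex_Analysis.Complex_Analysis"
begin

definition Hol :: "(complex \<Rightarrow> complex) set" where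
  "Hol = {f. f holomorphic_on UNIV}"

text \<open>For \<open>f \<in> Hol\<close> and \<open>\<rho> \<ge> 0\<close> the supremum is over a nonempty, bounded set of reals,
  so it is not a default value.\<close>

definition sup_norm_disc :: "real \<Rightarrow> (complex \<Rightarrow> complex) \<Rightarrow> real" where
  "sup_norm_disc \<rho> f = (SUP z\<in>{z. cmod z \<le> \<rho>}. cmod (f z))"

text \<open>Complex-linear maps \<open>Hol \<rightarrow> Hol\<close>. The function \<open>T\<close> is total, but only its values on
  \<open>Hol\<close> are constrained.\<close>

definition linear_operator_Hol :: "((complex \<Rightarrow> complex) \<Rightarrow> (complex \<Rightarrow> complex)) \<Rightarrow> bool" where
  "linear_operator_Hol T \<longleftrightarrow>
     T \<in> Hol \<rightarrow> Hol \<and>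
     (\<forall>f\<in>Hol. \<forall>g\<in>Hol. T (\<lambda>z. f z + g z) = (\<lambda>z. T f z + T g z)) \<and>
     (\<forall>c. \<forall>f\<in>Hol. T (\<lambda>z. c * f z) = (\<lambda>z. c * T f z))"

end

(* T maps z^n to an entire function bounded by |z|^n, hence to c n * z^n with |c n| <= 1.
   On the closed unit disc 1 + z + z^k has supremum 3, so the image
   c 0 + c 1 * z + c k * z^k attains modulus 3 at some z; its three terms must then be equal
   and unimodular, which gives c k = c 0 * (c 1 / c 0)^k. By the isometry, T is
   continuous for locally uniform convergence, so the formula passes from polynomials to all
   entire functions through their Taylor series. *)

theory Submission
  imports Defs
begin

text \<open>By the parallelogram law, the squared norms of a + b and a - b add up to at most 4, and
  a + b already uses up all of it.\<close>

lemma norm_add_eq_2_imp_eq: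
  fixes a b :: complex
  assumes "norm a \<le> 1" "norm b \<le> 1" "norm (a + b) \<ge> 2"
  shows "a = b"
proof -
  have "norm (a + b) ^ 2 + norm (a - b) ^ 2 = 2 * norm a ^ 2 + 2 * norm b ^ 2"
    unfolding cmod_power2 by (simp add: power2_eq_square algebra_simps)
  moreover have "norm a ^ 2 \<le> 1" "norm b ^ 2 \<le> 1"
    using assms by (auto intro: power_le_one)
  moreover have "norm (a + b) ^ 2 \<ge> 2 ^ 2"
    using assms(3) by (intro power_mono) auto
  ultimately have "norm (a - b) ^ 2 \<le> 0"
    unfolding power2_eq_square[of "2::real"] by linarith
  then show ?thesis
    by simp
qed

text \<open>Dropping one term lowers the norm of the sum by at most 1, so each pair containing a has
  a sum of norm at least 2 and the two-term case applies.\<close>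

lemma norm_add3_eq_3_imp_eq:
  fixes a b c :: complex
  assumes "norm a \<le> 1" "norm b \<le> 1" "norm c \<le> 1" "norm (a + b + c) = 3"
  shows "a = b" "a = c" "norm a = 1"
proof -
  have ab: "norm (a + b) \<ge> 2"
    using assms norm_triangle_ineq[of "a + b" c] by linarith
  have ac: "norm (a + c) \<ge> 2"
    using assms norm_triangle_ineq[of "a + c" b] by (simp add: algebra_simps)
  show "a = b" "a = c"
    using norm_add_eq_2_imp_eq ab ac assms by blast+
  then have "a + b + c = 3 * a"
    by simp
  with assms(4) show "norm a = 1"
    by (simp add: norm_mult)
qed

text \<open>This serves twice: boundedness makes the supremum in \<open>sup_norm_disc\<close> a
  genuine upper bound, and compactness makes it attained.\<close>

lemma compact_norm_image_Hol:
  assumes "f \<in> Hol"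
  shows "compact ((\<lambda>z. cmod (f z)) ` {z. cmod z \<le> \<rho>})"
proof -
  have eq: "{z. cmod z \<le> \<rho>} = cball 0 \<rho>"
    by auto
  have "continuous_on UNIV f"
    using assms by (simp add: Hol_def holomorphic_on_imp_continuous_on)
  then have "continuous_on (cball 0 \<rho>) (\<lambda>z. cmod (f z))"
    by (intro continuous_on_norm) (rule continuous_on_subset, auto)
  then show ?thesis
    unfolding eq by (rule compact_continuous_image) simp
qed

lemma norm_le_sup_norm_disc:
  assumes "f \<in> Hol" "cmod z \<le> \<rho>"
  shows "cmod (f z) \<le> sup_norm_disc \<rho> f"
  unfolding sup_norm_disc_def
  using assms compact_norm_image_Hol[of f \<rho>]
  by (intro cSUP_upper) (auto dest: compact_imp_bounded intro: bounded_imp_bdd_above)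

lemma sup_norm_disc_le:
  assumes "\<rho> \<ge> 0" "\<And>z. cmod z \<le> \<rho> \<Longrightarrow> cmod (f z) \<le> B"
  shows "sup_norm_disc \<rho> f \<le> B"
  unfolding sup_norm_disc_def
  using assms by (intro cSUP_least) (auto intro: exI[of _ 0])

lemma sup_norm_disc_attained:
  assumes "f \<in> Hol" "\<rho> \<ge> 0"
  obtains z where "cmod z \<le> \<rho>" "cmod (f z) = sup_norm_disc \<rho> f"
proof -
  have ne: "(\<lambda>z. cmod (f z)) ` {z. cmod z \<le> \<rho>} \<noteq> {}"
    using assms(2) by (auto intro: exI[of _ 0])
  from compact_attains_sup[OF compact_norm_image_Hol[OF assms(1)] ne]
  obtain z where z: "cmod z \<le> \<rho>" "\<And>w. cmod w \<le> \<rho> \<Longrightarrow> cmod (f w) \<le> cmod (f z)"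
    by auto
  have "cmod (f z) = sup_norm_disc \<rho> f"
    by (intro antisym norm_le_sup_norm_disc sup_norm_disc_le assms z)
  with z(1) that show thesis
    by blast
qed

lemma nonpos_if_le_all_powers:
  fixes x :: real
  assumes "m > 0" "\<And>r. r > 0 \<Longrightarrow> x \<le> r ^ m"
  shows "x \<le> 0"
proof (rule ccontr)
  assume "\<not> x \<le> 0"
  \<comment> \<open>The bound 1/2 ensures r^m \<le> r, and x/2 keeps r below x.\<close>
  define r where "r = min (1/2) (x/2)"
  have r: "r > 0" "r \<le> 1" "r < x"
    using \<open>\<not> x \<le> 0\<close> by (auto simp: r_def min_def)
  have "r ^ m \<le> r ^ 1"
    using r assms(1) by (intro power_decreasing) auto
  with assms(2)[OF r(1)] r show False
    by simp
qed

text \<open>Cauchy's inequality on the circle of radius r bounds the Taylor coefficient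
  \<open>a k\<close> by r^n / r^k. Letting r tend to 0 kills the coefficients with k < n, letting r
  grow kills those with k > n, and r = 1 bounds the remaining one.\<close>

lemma holomorphic_le_power_imp_monomial:
  assumes hol: "g holomorphic_on UNIV" and le: "\<And>z. cmod (g z) \<le> cmod z ^ n"
  obtains c where "cmod c \<le> 1" "\<And>z. g z = c * z ^ n"
proof -
  define a where "a k = (deriv ^^ k) g 0 / fact k" for k
  have cauchy: "cmod (a k) * r ^ k \<le> r ^ n" if "r > 0" for k r
  proof -
    have "cmod ((deriv ^^ k) g 0) \<le> fact k * r ^ n / r ^ k"
    proof (rule Cauchy_inequality)
      show "g holomorphic_on ball 0 r" "continuous_on (cball 0 r) g"
        using hol by (auto intro: holomorphic_on_subset holomorphic_on_imp_continuous_on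
            continuous_on_subset)
      show "cmod (g x) \<le> r ^ n" if "cmod (0 - x) = r" for x
        using le[of x] that by simp
    qed (fact that)
    then show ?thesis
      using that by (simp add: a_def norm_divide field_simps)
  qed
  have zero: "a k = 0" if "k \<noteq> n" for k
  proof -
    have "cmod (a k) \<le> 0"
    proof (cases "k < n")
      case True
      show ?thesis
      proof (rule nonpos_if_le_all_powers)
        show "cmod (a k) \<le> r ^ (n - k)" if "r > 0" for r
          using cauchy[OF that, of k] that True by (simp add: power_diff field_simps)
      qed (use True in simp)
    next
      case False
      show ?thesis
      proof (rule nonpos_if_le_all_powers)
        show "cmod (a k) \<le> r ^ (k - n)" if "r > 0" for r
          \<comment> \<open>Large radii are written as reciprocals, so that
            \<open>nonpos_if_le_all_powers\<close> covers this case too.\<close>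
          using cauchy[of "1 / r" k] that False
          by (simp add: power_diff power_divide field_simps)
      qed (use False that in simp)
    qed
    then show ?thesis
      by simp
  qed
  have "g z = a n * z ^ n" for z
  proof -
    have "(\<lambda>k. a k * z ^ k) sums g z"
      using holomorphic_power_series[of g 0 "cmod z + 1" z] hol
      by (auto simp: a_def intro: holomorphic_on_subset)
    moreover have "(\<lambda>k. a k * z ^ k) sums (\<Sum>k\<in>{n}. a k * z ^ k)"
      using zero by (intro sums_finite) auto
    ultimately show ?thesis
      using sums_unique2 by fastforce
  qed
  moreover have "cmod (a n) \<le> 1"
    using cauchy[of 1 n] by simp
  ultimately show thesis
    using that by blast
qed

lemma Taylor_uniform_limit_Hol:
  assumes "f \<in> Hol"
  shows "uniform_limit (cball 0 \<rho>)
           (\<lambda>N z. \<Sum>k<N. (deriv ^^ k) f 0 / fact k * z ^ k) f sequentially"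
proof -
  define a where "a k = (deriv ^^ k) f 0 / fact k" for k
  have sums: "(\<lambda>k. a k * z ^ k) sums f z" for z
    using holomorphic_power_series[of f 0 "cmod z + 1" z] assms
    by (auto simp: a_def Hol_def intro: holomorphic_on_subset)
  \<comment> \<open>This is the majorant for the Weierstrass M-test. The series converges at the
    point \<bar>\<rho>\<bar> + 1 of strictly larger modulus, hence absolutely at \<rho>.\<close>
  have "summable (\<lambda>k. cmod (a k * complex_of_real \<rho> ^ k))"
    using powser_insidea[of a "complex_of_real (\<bar>\<rho>\<bar> + 1)" "complex_of_real \<rho>"] sums
    by (simp add: sums_iff)
  then have "uniform_limit (cball 0 \<rho>) (\<lambda>N z. \<Sum>k<N. a k * z ^ k) (\<lambda>z. \<Sum>k. a k * z ^ k)
      sequentially"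
    by (rule Weierstrass_m_test[rotated])
      (auto simp: norm_mult norm_power intro!: mult_left_mono power_mono)
  then show ?thesis
    using sums by (simp add: a_def sums_iff)
qed

lemma Hol_monomial: "(\<lambda>z. z ^ n) \<in> Hol"
  by (auto simp: Hol_def intro!: holomorphic_intros)

lemma Hol_polynomial: "(\<lambda>z. \<Sum>k<N. a k * z ^ k) \<in> Hol"
  by (auto simp: Hol_def intro!: holomorphic_intros)

lemma linear_operator_Hol_add:
  assumes "linear_operator_Hol T" "f \<in> Hol" "g \<in> Hol"
  shows "T (\<lambda>z. f z + g z) = (\<lambda>z. T f z + T g z)"
  using assms by (simp add: linear_operator_Hol_def)

lemma linear_operator_Hol_cmult:
  assumes "linear_operator_Hol T" "f \<in> Hol"
  shows "T (\<lambda>z. c * f z) = (\<lambda>z. c * T f z)"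
  using assms by (simp add: linear_operator_Hol_def)

lemma linear_operator_Hol_polynomial:
  assumes "linear_operator_Hol T"
  shows "T (\<lambda>z. \<Sum>k<N. a k * z ^ k) = (\<lambda>z. \<Sum>k<N. a k * T (\<lambda>w. w ^ k) z)"
proof (induction N)
  case 0
  show ?case
    \<comment> \<open>The empty sum is the zero function, obtained here as 0 times a
      monomial.\<close>
    using linear_operator_Hol_cmult[OF assms Hol_monomial, of 0 0] by simp
next
  case (Suc N)
  have "(\<lambda>z. a N * z ^ N) \<in> Hol"
    by (auto simp: Hol_def intro!: holomorphic_intros)
  from linear_operator_Hol_add[OF assms Hol_polynomial this, of a N]
    linear_operator_Hol_cmult[OF assms Hol_monomial, of "a N" N] Suc
  show ?case
    by simp
qed

theorem mainTheorem3:
  fixes T :: "(complex \<Rightarrow> complex) \<Rightarrow> (complex \<Rightarrow> complex)"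
  assumes "linear_operator_Hol T"
    and "\<And>f \<rho>. f \<in> Hol \<Longrightarrow> \<rho> \<ge> 0 \<Longrightarrow> sup_norm_disc \<rho> (T f) = sup_norm_disc \<rho> f"
  shows "\<exists>\<alpha>\<in>sphere (0::complex) 1. \<exists>\<beta>\<in>sphere (0::complex) 1.
           \<forall>f\<in>Hol. \<forall>z. T f z = \<alpha> * f (\<beta> * z)"
proof -
  have T_Hol: "T f \<in> Hol" if "f \<in> Hol" for f
    using assms(1) that by (auto simp: linear_operator_Hol_def)
  note T_add = linear_operator_Hol_add[OF assms(1)]
  \<comment> \<open>The isometry at radius \<open>cmod z\<close> becomes a pointwise bound, used
    first for monomials and later for the continuity of T.\<close>
  have T_le: "cmod (T f z) \<le> B" if "f \<in> Hol" "\<And>w. cmod w \<le> cmod z \<Longrightarrow> cmod (f w) \<le> B" for f z B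
    using norm_le_sup_norm_disc[OF T_Hol[OF that(1)], of z "cmod z"]
      assms(2)[OF that(1), of "cmod z"] sup_norm_disc_le[of "cmod z" f B] that(2) by force

  have "\<exists>c. cmod c \<le> 1 \<and> (\<forall>z. T (\<lambda>w. w ^ n) z = c * z ^ n)" for n
  proof (rule holomorphic_le_power_imp_monomial)
    show "T (\<lambda>w. w ^ n) holomorphic_on UNIV"
      using T_Hol[OF Hol_monomial] by (simp add: Hol_def)
    show "cmod (T (\<lambda>w. w ^ n) z) \<le> cmod z ^ n" for z
      by (rule T_le[OF Hol_monomial]) (simp add: norm_power power_mono)
  qed blast
  then obtain c where c: "\<And>n. cmod (c n) \<le> 1" "\<And>n z. T (\<lambda>w. w ^ n) z = c n * z ^ n"
    by metis

  have key: "\<exists>z. cmod z = 1 \<and> cmod (c 0) = 1 \<and> c 0 = c 1 * z \<and> c 0 = c k * z ^ k" for k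
  proof -
    \<comment> \<open>Writing 1 and z as powers lets \<open>c(2)\<close> apply to all three terms.
      The cases k = 0 and k = 1 need no separate treatment, since f 1 = 3 there as well.\<close>
    define f where "f = (\<lambda>z::complex. (z ^ 0 + z ^ 1) + z ^ k)"
    have f: "f \<in> Hol"
      by (auto simp: Hol_def f_def intro!: holomorphic_intros)
    have "(\<lambda>z::complex. z ^ 0 + z ^ 1) \<in> Hol"
      by (auto simp: Hol_def intro!: holomorphic_intros)
    then have "T f = (\<lambda>z. T (\<lambda>z. z ^ 0 + z ^ 1) z + T (\<lambda>z. z ^ k) z)"
      unfolding f_def by (rule T_add[OF _ Hol_monomial])
    then have Tf: "T f z = c 0 + c 1 * z + c k * z ^ k" for z
      unfolding T_add[OF Hol_monomial Hol_monomial] c(2) by simp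
    obtain z where z: "cmod z \<le> 1" "cmod (T f z) = sup_norm_disc 1 f"
      using sup_norm_disc_attained[OF T_Hol[OF f], of 1] assms(2)[OF f, of 1] by auto
    have terms: "cmod (c 1 * z) \<le> 1" "cmod (c k * z ^ k) \<le> 1"
      using c(1) z(1) by (auto simp: norm_mult norm_power intro!: mult_le_one power_le_one)
    have "cmod (f 1) \<le> sup_norm_disc 1 f"
      by (rule norm_le_sup_norm_disc[OF f]) simp
    then have "cmod (c 0 + c 1 * z + c k * z ^ k) \<ge> 3"
      using z(2) unfolding Tf by (simp add: f_def)
    moreover have "cmod (c 0 + c 1 * z + c k * z ^ k) \<le> 1 + 1 + 1"
      by (intro norm_triangle_le add_mono c(1) terms)
    ultimately have "cmod (c 0 + c 1 * z + c k * z ^ k) = 3"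
      by simp
    note eq = norm_add3_eq_3_imp_eq[OF c(1) terms this]
    \<comment> \<open>Since \<open>c 1 * z\<close> is unimodular and \<open>c 1\<close> has modulus
      at most 1, the maximum point z cannot lie inside the unit circle.\<close>
    have "1 = cmod (c 1) * cmod z"
      using eq by (metis norm_mult)
    also have "\<dots> \<le> 1 * cmod z"
      by (intro mult_right_mono c(1)) auto
    finally show ?thesis
      using z(1) eq by (intro exI[of _ z]) auto
  qed

  define \<alpha> \<beta> where "\<alpha> = c 0" and "\<beta> = c 1 / c 0"
  have c_eq: "c k = \<alpha> * \<beta> ^ k" for k
  proof -
    \<comment> \<open>The point z may vary with k, but its relation to \<open>c 1\<close> identifies
      it as the inverse of \<beta>, which does not.\<close>
    obtain z where z: "cmod z = 1" "cmod (c 0) = 1" "c 0 = c 1 * z" "c 0 = c k * z ^ k"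
      using key by blast
    have "c 0 \<noteq> 0"
      using z(2) by auto
    then have "\<beta> * z = 1"
      unfolding \<beta>_def times_divide_eq_left z(3)[symmetric] by (rule divide_self)
    then have "\<beta> ^ k * z ^ k = 1"
      by (simp flip: power_mult_distrib)
    then have "c k = c k * z ^ k * \<beta> ^ k"
      by (simp add: mult.assoc mult.commute)
    with z(4) show ?thesis
      by (simp add: \<alpha>_def)
  qed
  have norms: "cmod \<alpha> = 1" "cmod \<beta> = 1"
  proof -
    obtain z where z: "cmod z = 1" "cmod (c 0) = 1" "c 0 = c 1 * z"
      using key by blast
    then have "cmod (c 1) = 1"
      by (metis norm_mult mult.right_neutral)
    with z(2) show "cmod \<alpha> = 1" "cmod \<beta> = 1"
      unfolding \<alpha>_def \<beta>_def norm_divide by simp_all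
  qed

  have "T f z = \<alpha> * f (\<beta> * z)" if f: "f \<in> Hol" for f z
  proof -
    define p where "p N = (\<lambda>z. \<Sum>k<N. (deriv ^^ k) f 0 / fact k * z ^ k)" for N
    have p: "p N \<in> Hol" for N
      unfolding p_def by (rule Hol_polynomial)
    have Tp: "T (p N) z = \<alpha> * p N (\<beta> * z)" for N
      unfolding p_def linear_operator_Hol_polynomial[OF assms(1)] c(2) c_eq
      by (simp add: sum_distrib_left power_mult_distrib mult_ac)
    \<comment> \<open>One disc serves both limits below: it contains \<beta> * z because \<beta> is
      unimodular, and it is the disc on which \<open>T_le\<close> needs a bound.\<close>
    have lim: "uniform_limit (cball 0 (cmod z)) p f sequentially"
      using Taylor_uniform_limit_Hol[OF f] by (simp add: p_def[abs_def])
    have "(\<lambda>N. p N (\<beta> * z)) \<longlonglongrightarrow> f (\<beta> * z)"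
      by (rule tendsto_uniform_limitI[OF lim]) (simp add: norm_mult norms)
    then have "(\<lambda>N. T (p N) z) \<longlonglongrightarrow> \<alpha> * f (\<beta> * z)"
      unfolding Tp by (intro tendsto_intros)
    moreover have "(\<lambda>N. T (p N) z) \<longlonglongrightarrow> T f z"
    proof (rule tendstoI)
      fix e :: real
      assume "e > 0"
      \<comment> \<open>Halving e restores strictness, as \<open>T_le\<close> yields only a weak
        inequality for the image of p N - f.\<close>
      then have "\<forall>\<^sub>F N in sequentially. \<forall>w\<in>cball 0 (cmod z). dist (p N w) (f w) < e / 2"
        using uniform_limitD[OF lim, of "e / 2"] by simp
      then show "\<forall>\<^sub>F N in sequentially. dist (T (p N) z) (T f z) < e"
      proof eventually_elim
        case (elim N)
        define h where "h = (\<lambda>w. p N w - f w)"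
        have h: "h \<in> Hol"
          using p[of N] f by (auto simp: h_def Hol_def intro!: holomorphic_intros)
        have "T (\<lambda>w. h w + f w) = (\<lambda>w. T h w + T f w)"
          by (rule T_add[OF h f])
        then have "T (p N) z = T h z + T f z"
          by (simp add: h_def)
        moreover have "cmod (T h z) \<le> e / 2"
          using elim by (intro T_le[OF h]) (force simp: h_def dist_norm)
        ultimately show ?case
          using \<open>e > 0\<close> by (simp add: dist_norm)
      qed
    qed
    ultimately show ?thesis
      using LIMSEQ_unique by blast
  qed
  with norms show ?thesis
    by (intro bexI[of _ \<alpha>] bexI[of _ \<beta>]) simp_all
qed

end
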